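(* Let $\mathcal{V}$ be the set of symmetric matrices of the form $$\begin{pmatrix} A & S \\ -S & A \end{pmatrix},$$ such that $A \in M_n(\mathbb{R})$ is a symmetric matrix and $S \in M_n(\mathbb{R})$ is a skew-symmetric matrix. Then $\mathcal{V}$ is a vector space of dimension $\frac{n^2}{2}$ in which the characteristic polynomial of every matrix is a square.
   Context: $M_n(\mathbb{R})$ denotes the set of all $n \times n$ matrices with real entries, so the matrices in $\mathcal{V}$ are real of size $2n \times 2n$. The characteristic polynomial $p(x)=\det(xI-M)$ of a real symmetric matrix $M$ is a square if $p(x)=g(x)^2$ for some $g(x)\in\mathbb{R}[x]$; equivalently, all eigenvalues of $M$ have even multiplicity.
   Formalization: The dimension n²/2 is corrected to n²: symmetric A contributes n(n+1)/2 and skew-symmetric S contributes n(n−1)/2; for n = 1 the space is all real multiples of the 2×2 identity, of dimension 1, not 1/2. *)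

theory Defs
  imports "Jordan_Normal_Form.VS_Connect" "Jordan_Normal_Form.Char_Poly"
begin

definition sym_skew_block_mats :: "nat \<Rightarrow> real mat set" where
  "sym_skew_block_mats n =
     {M. transpose_mat M = M \<and>
         (\<exists>A S. A \<in> carrier_mat n n \<and> S \<in> carrier_mat n n \<and>
                transpose_mat A = A \<and> transpose_mat S = - S \<and>
                M = four_block_mat A S (- S) A)}"

(* The set above with the operations inherited from the space of all 2n x 2n matrices.
   In the theorem, vectorspace.fin_dim accompanies vectorspace.dim because the latter is
   a LEAST over finite generating sets and is unspecified if there are none. *)
abbreviation sym_skew_block_space :: "nat \<Rightarrow> (real, real mat) module" where
  "sym_skew_block_space n \<equiv>
     (module_mat TYPE(real) (2 * n) (2 * n))\<lparr>carrier := sym_skew_block_mats n\<rparr>"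

end

theory Submission
  imports Defs
begin

text \<open>
  Over the complex numbers, conjugation by a block unipotent matrix makes the block matrix
  with rows \<open>(A, S)\<close> and \<open>(-S, A)\<close> block triangular with diagonal blocks \<open>A - iS\<close> and \<open>A + iS\<close>.
  These two blocks are transposes of each other, so the characteristic polynomial is a square
  over the complex numbers; they are also complex conjugates of each other, so the square root
  has real coefficients.  The dimension comes from the linear bijection that sends an arbitrary
  \<open>n \<times> n\<close> matrix \<open>X\<close> to the pair \<open>A = X + X\<^sup>T\<close>, \<open>S = X - X\<^sup>T\<close>.
\<close>

section \<open>The characteristic polynomial\<close>

text \<open>Off the diagonal blocks, \<open>char_poly_matrix\<close> only negates entries, so the
  zero block survives and the determinant of a block triangular polynomial matrix factors.\<close>

lemma char_poly_four_block_upper_right_zero: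
  fixes A :: "'a :: idom mat"
  assumes A: "A \<in> carrier_mat n n" and C: "C \<in> carrier_mat m n" and D: "D \<in> carrier_mat m m"
  shows "char_poly (four_block_mat A (0\<^sub>m n m) C D) = char_poly A * char_poly D"
proof -
  let ?C = "map_mat (\<lambda>a. [:- a:]) C"
  have "char_poly_matrix (four_block_mat A (0\<^sub>m n m) C D)
      = four_block_mat (char_poly_matrix A) (0\<^sub>m n m) ?C (char_poly_matrix D)"
    by (rule eq_matI) (use A C D in \<open>auto simp: char_poly_matrix_def\<close>)
  then show ?thesis
    using A C D by (simp add: char_poly_def det_four_block_mat_upper_right_zero[where n = n and m = m])
qed

lemma char_poly_rotation_block:
  fixes A S :: "complex mat"
  assumes A: "A \<in> carrier_mat n n" and S: "S \<in> carrier_mat n n"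
  shows "char_poly (four_block_mat A S (- S) A)
       = char_poly (A - \<i> \<cdot>\<^sub>m S) * char_poly (A + \<i> \<cdot>\<^sub>m S)"
proof -
  let ?I = "1\<^sub>m n :: complex mat" and ?O = "0\<^sub>m n n :: complex mat"
  let ?P = "four_block_mat ?I (\<i> \<cdot>\<^sub>m ?I) ?O ?I"
  let ?Q = "four_block_mat ?I (- \<i> \<cdot>\<^sub>m ?I) ?O ?I"
  let ?M = "four_block_mat A S (- S) A"
  let ?L = "four_block_mat (A - \<i> \<cdot>\<^sub>m S) ?O (- S) (A + \<i> \<cdot>\<^sub>m S)"
  have carrier: "{?L, ?M, ?P, ?Q} \<subseteq> carrier_mat (n + n) (n + n)"
    using A S by auto
  have "?P * ?Q = four_block_mat ?I ?O ?O ?I"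
    by (subst mult_four_block_mat[of _ n n _ n _ n _ _ n _ n])
       (auto intro!: cong_four_block_mat eq_matI)
  moreover have "?Q * ?P = four_block_mat ?I ?O ?O ?I"
    by (subst mult_four_block_mat[of _ n n _ n _ n _ _ n _ n])
       (auto intro!: cong_four_block_mat eq_matI)
  ultimately have inverse: "?P * ?Q = 1\<^sub>m (n + n)" "?Q * ?P = 1\<^sub>m (n + n)"
    by simp_all
  \<comment> \<open>Row operation: \<i> times the second block row is added to the first.\<close>
  have "?P * ?M = four_block_mat (A - \<i> \<cdot>\<^sub>m S) (S + \<i> \<cdot>\<^sub>m A) (- S) A"
    using A S
    by (subst mult_four_block_mat[of _ n n _ n _ n _ _ n _ n])
       (auto intro!: cong_four_block_mat simp: mult_smult_assoc_mat)
  \<comment> \<open>The upper right block S + \<i>A equals \<i>(A - \<i>S), so subtracting \<i>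
    times the first block column from the second clears it.\<close>
  moreover have "four_block_mat (A - \<i> \<cdot>\<^sub>m S) (S + \<i> \<cdot>\<^sub>m A) (- S) A * ?Q = ?L"
    using A S
    by (subst mult_four_block_mat[of _ n n _ n _ n _ _ n _ n])
       (auto intro!: cong_four_block_mat simp: mult_smult_distrib algebra_simps)
  ultimately have "?L = ?P * ?M * ?Q"
    by simp
  then have "char_poly ?M = char_poly ?L"
    using similar_matI[OF carrier inverse] char_poly_similar by metis
  also have "\<dots> = char_poly (A - \<i> \<cdot>\<^sub>m S) * char_poly (A + \<i> \<cdot>\<^sub>m S)"
    using A S by (intro char_poly_four_block_upper_right_zero) auto
  finally show ?thesis .
qed

section \<open>Descent of the square root to real coefficients\<close>

interpretation cnj_hom: comm_ring_hom cnj
  by unfold_locales auto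

text \<open>\<open>Re\<close> is not multiplicative, so \<open>map_poly Re\<close> acts only
  coefficient by coefficient; invariance under conjugation makes every coefficient real, so nothing
  is lost.\<close>

lemma map_poly_of_real_Re:
  assumes "map_poly cnj p = p"
  shows "map_poly complex_of_real (map_poly Re p) = p"
proof (rule poly_eqI)
  fix k
  have "cnj (coeff p k) = coeff p k"
    using arg_cong[OF assms, of "\<lambda>q. coeff q k"] by (simp add: coeff_map_poly)
  then show "coeff (map_poly complex_of_real (map_poly Re p)) k = coeff p k"
    by (simp add: coeff_map_poly complex_eq_iff)
qed

lemma symmetric_entry:
  assumes "A \<in> carrier_mat n n" "transpose_mat A = A" "i < n" "j < n"
  shows "A $$ (j, i) = A $$ (i, j)"
  using assms by (metis carrier_matD index_transpose_mat(1))

lemma skew_entry: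
  assumes "S \<in> carrier_mat n n" "transpose_mat S = - S" "i < n" "j < n"
  shows "S $$ (j, i) = - S $$ (i, j)"
  using assms by (metis carrier_matD index_transpose_mat(1) index_uminus_mat(1))

lemma char_poly_rotation_block_square:
  fixes A S :: "real mat"
  assumes A: "A \<in> carrier_mat n n" and S: "S \<in> carrier_mat n n"
    and sym: "transpose_mat A = A" and skew: "transpose_mat S = - S"
  shows "\<exists>g :: real poly. char_poly (four_block_mat A S (- S) A) = g\<^sup>2"
proof -
  interpret of_real_poly: map_poly_comm_ring_hom complex_of_real ..
  let ?A = "map_mat complex_of_real A" and ?S = "map_mat complex_of_real S"
  let ?H = "?A + \<i> \<cdot>\<^sub>m ?S" and ?M = "four_block_mat A S (- S) A"
  define h where "h = char_poly ?H"
  have H: "?H \<in> carrier_mat n n"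
    using A S by auto
  \<comment> \<open>Transposition fixes \<open>?A\<close> and negates \<open>?S\<close>; hence the
    two factors of the characteristic polynomial coincide.\<close>
  have "?A - \<i> \<cdot>\<^sub>m ?S = transpose_mat ?H"
  proof (rule eq_matI)
    fix i j assume "i < dim_row (transpose_mat ?H)" "j < dim_col (transpose_mat ?H)"
    then show "(?A - \<i> \<cdot>\<^sub>m ?S) $$ (i, j) = transpose_mat ?H $$ (i, j)"
      using A S symmetric_entry[OF A sym, of i j] skew_entry[OF S skew, of i j] by simp
  qed (use A S in auto)
  then have minus: "char_poly (?A - \<i> \<cdot>\<^sub>m ?S) = h"
    using char_poly_transpose_mat[OF H] by (simp add: h_def)
  \<comment> \<open>\<open>A\<close> and \<open>S\<close> are real, so conjugation only flips the
    sign of \<i>. As this again gives the transpose of \<open>?H\<close>, the polynomial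
    \<open>h\<close> is fixed by conjugation.\<close>
  have "map_mat cnj ?H = ?A - \<i> \<cdot>\<^sub>m ?S"
    by (rule eq_matI) (use A S in auto)
  then have "map_poly cnj h = h"
    using cnj_hom.char_poly_hom[OF H] minus by (simp add: h_def)
  then have real: "map_poly complex_of_real (map_poly Re h) = h"
    by (rule map_poly_of_real_Re)
  have "map_mat complex_of_real ?M = four_block_mat ?A ?S (- ?S) ?A"
    by (rule eq_matI) (use A S in auto)
  moreover have "char_poly (map_mat complex_of_real ?M) = map_poly complex_of_real (char_poly ?M)"
    by (rule of_real_hom.char_poly_hom[of _ "n + n"]) (use A in auto)
  ultimately have "map_poly complex_of_real (char_poly ?M) = h * h"
    using A S char_poly_rotation_block[of ?A n ?S] minus by (simp add: h_def[symmetric])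
  also have "\<dots> = map_poly complex_of_real ((map_poly Re h)\<^sup>2)"
    by (simp add: of_real_poly.hom_mult power2_eq_square real)
  \<comment> \<open>The embedding of the reals is injective on coefficients.\<close>
  finally have "char_poly ?M = (map_poly Re h)\<^sup>2"
    by (simp add: poly_eq_iff coeff_map_poly)
  then show ?thesis ..
qed

section \<open>The dimension\<close>

text \<open>Rank-nullity with zero kernel and full image; this carries the known dimension of a
  coordinate space over to the block matrices.\<close>

lemma (in linear_map) dim_eq_of_bij:
  assumes fd: "V.fin_dim" and bij: "bij_betw T (carrier V) (carrier W)"
  shows "W.fin_dim" "W.dim = V.dim"
proof -
  have surj: "T ` carrier V = carrier W"
    using bij by (simp add: bij_betw_def)
  show "W.fin_dim"
    using rank_nullity_main(2)[OF fd surj] .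
  have ker: "kerT = {\<zero>\<^bsub>V\<^esub>}"
  proof (intro equalityI subsetI)
    fix v assume "v \<in> kerT"
    then have "v \<in> carrier V" "T v = T \<zero>\<^bsub>V\<^esub>"
      by (simp_all add: ker_def)
    then show "v \<in> {\<zero>\<^bsub>V\<^esub>}"
      using inj_onD[OF bij_betw_imp_inj_on[OF bij]] by blast
  qed (simp add: ker_def)
  interpret ker: vectorspace K "V.vs kerT"
    using V.subspace_is_vs[OF kerT_is_subspace] .
  \<comment> \<open>The empty set generates the zero kernel, which bounds its dimension by
    0.\<close>
  have "ker.span {} = {\<zero>\<^bsub>V\<^esub>}"
    by (auto simp: ker.span_def ker.lincomb_def)
  then have "ker.dim = 0"
    using ker.gen_ge_dim[of "{}"] by (simp add: ker)
  moreover have "W.vs imT = W"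
    using surj by (simp add: im_def)
  ultimately show "W.dim = V.dim"
    using rank_nullity[OF fd] by simp
qed

section \<open>The block matrices as a subspace\<close>

text \<open>Transposition swaps the off-diagonal blocks and transposes each; for skew-symmetric
  \<open>S\<close> these two changes cancel.\<close>

lemma sym_skew_block_matsI:
  assumes "A \<in> carrier_mat n n" "S \<in> carrier_mat n n"
    and "transpose_mat A = A" "transpose_mat S = - S"
  shows "four_block_mat A S (- S) A \<in> sym_skew_block_mats n"
proof -
  have "transpose_mat (- S) = S"
    using assms(4) by (metis transpose_transpose uminus_uminus_mat transpose_uminus)
  then have "transpose_mat (four_block_mat A S (- S) A) = four_block_mat A S (- S) A"
    using assms by (simp add: transpose_four_block_mat[of _ n n _ n _ n])
  then show ?thesis
    using assms by (auto simp: sym_skew_block_mats_def)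
qed

lemma sym_skew_block_matsE:
  assumes "M \<in> sym_skew_block_mats n"
  obtains A S where "A \<in> carrier_mat n n" "S \<in> carrier_mat n n"
    "transpose_mat A = A" "transpose_mat S = - S" "M = four_block_mat A S (- S) A"
  using assms by (auto simp: sym_skew_block_mats_def)

text \<open>The block form is linear in the pair \<open>A\<close>, \<open>S\<close>, and symmetry
  and skew-symmetry are preserved by sums and scalar multiples.\<close>

lemma sym_skew_block_mats_subspace:
  "VectorSpace.subspace class_ring (sym_skew_block_mats n)
     (module_mat TYPE(real) (2 * n) (2 * n))"
proof -
  let ?V = "module_mat TYPE(real) (2 * n) (2 * n)"
  interpret V: vectorspace "class_ring :: real ring" ?V
    by (rule matrix_vs)
  have zero: "0\<^sub>m (2 * n) (2 * n) \<in> sym_skew_block_mats n"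
  proof -
    have "four_block_mat (0\<^sub>m n n) (0\<^sub>m n n) (- 0\<^sub>m n n) (0\<^sub>m n n) \<in> sym_skew_block_mats n"
      by (rule sym_skew_block_matsI) (auto intro!: eq_matI)
    moreover have "- 0\<^sub>m n n = (0\<^sub>m n n :: real mat)"
      by (auto intro!: eq_matI)
    ultimately show ?thesis
      by (simp add: mult_2)
  qed
  have add: "M + N \<in> sym_skew_block_mats n"
    if M_in: "M \<in> sym_skew_block_mats n" and N_in: "N \<in> sym_skew_block_mats n" for M N
  proof -
    obtain A S where M: "A \<in> carrier_mat n n" "S \<in> carrier_mat n n"
      "transpose_mat A = A" "transpose_mat S = - S" "M = four_block_mat A S (- S) A"
      using M_in by (rule sym_skew_block_matsE)
    obtain B R where N: "B \<in> carrier_mat n n" "R \<in> carrier_mat n n"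
      "transpose_mat B = B" "transpose_mat R = - R" "N = four_block_mat B R (- R) B"
      using N_in by (rule sym_skew_block_matsE)
    have "M + N = four_block_mat (A + B) (S + R) (- (S + R)) (A + B)"
      by (rule eq_matI) (use M N in auto)
    moreover have "transpose_mat (S + R) = - (S + R)"
      using M N by (auto simp: transpose_add intro!: eq_matI)
    ultimately show ?thesis
      using M N sym_skew_block_matsI[of "A + B" n "S + R"] by (simp add: transpose_add)
  qed
  have smult: "c \<cdot>\<^sub>m M \<in> sym_skew_block_mats n" if M_in: "M \<in> sym_skew_block_mats n" for c M
  proof -
    obtain A S where M: "A \<in> carrier_mat n n" "S \<in> carrier_mat n n"
      "transpose_mat A = A" "transpose_mat S = - S" "M = four_block_mat A S (- S) A"
      using M_in by (rule sym_skew_block_matsE)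
    have "c \<cdot>\<^sub>m M = four_block_mat (c \<cdot>\<^sub>m A) (c \<cdot>\<^sub>m S) (- (c \<cdot>\<^sub>m S)) (c \<cdot>\<^sub>m A)"
      by (rule eq_matI) (use M in auto)
    moreover have "transpose_mat (c \<cdot>\<^sub>m A) = c \<cdot>\<^sub>m A"
      by (rule eq_matI) (use M symmetric_entry[OF M(1,3)] in auto)
    moreover have "transpose_mat (c \<cdot>\<^sub>m S) = - (c \<cdot>\<^sub>m S)"
    proof (rule eq_matI)
      fix i j assume "i < dim_row (- (c \<cdot>\<^sub>m S))" "j < dim_col (- (c \<cdot>\<^sub>m S))"
      then show "transpose_mat (c \<cdot>\<^sub>m S) $$ (i, j) = (- (c \<cdot>\<^sub>m S)) $$ (i, j)"
        using M(2) skew_entry[OF M(2,4), of i j] by simp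
    qed (use M in auto)
    ultimately show ?thesis
      using M sym_skew_block_matsI[of "c \<cdot>\<^sub>m A" n "c \<cdot>\<^sub>m S"] by simp
  qed
  have subset: "sym_skew_block_mats n \<subseteq> carrier_mat (2 * n) (2 * n)"
    by (auto simp: sym_skew_block_mats_def mult_2)
  show ?thesis
    by unfold_locales (use zero add smult subset in \<open>auto simp: module_mat_simps\<close>)
qed

section \<open>Coordinates on the space of block matrices\<close>

text \<open>The vector lists the entries of \<open>X\<close> row by row; vectors are used as the
  domain because the dimension of \<open>module_vec\<close> is available as
  \<open>dim_is_n\<close>.\<close>

definition block_of_vec :: "nat \<Rightarrow> real vec \<Rightarrow> real mat" where
  "block_of_vec n v =
     (let X = mat n n (\<lambda>(i, j). v $ (i * n + j))
      in four_block_mat (X + transpose_mat X) (X - transpose_mat X)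
           (- (X - transpose_mat X)) (X + transpose_mat X))"

lemma index_pair_less:
  assumes "i < n" "j < n"
  shows "i * n + j < n * (n :: nat)"
proof -
  have "i * n + j < Suc i * n"
    using assms by simp
  also have "\<dots> \<le> n * n"
    using assms by (intro mult_right_mono) auto
  finally show ?thesis .
qed

text \<open>From A = X + X^T and S = X - X^T one recovers X = (A + S)/2, the splitting of a matrix
  into symmetric and skew-symmetric parts.\<close>

lemma block_of_vec_bij:
  "bij_betw (block_of_vec n) (carrier_vec (n * n)) (sym_skew_block_mats n)"
proof (rule bij_betwI')
  fix v w :: "real vec"
  assume v: "v \<in> carrier_vec (n * n)" and w: "w \<in> carrier_vec (n * n)"
  show "block_of_vec n v = block_of_vec n w \<longleftrightarrow> v = w"
  proof
    assume eq: "block_of_vec n v = block_of_vec n w"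
    show "v = w"
    proof (rule eq_vecI)
      fix k assume "k < dim_vec w"
      then have k: "k < n * n" using w by simp
      then have n: "0 < n" by (cases n) auto
      define i j where "i = k div n" and "j = k mod n"
      have ij: "i < n" "j < n" and k_eq: "k = i * n + j"
        using k n by (auto simp: i_def j_def less_mult_imp_div_less)
      have "v $ (i * n + j) + v $ (j * n + i) = w $ (i * n + j) + w $ (j * n + i)"
        using arg_cong[OF eq, of "\<lambda>M. M $$ (i, j)"] ij by (simp add: block_of_vec_def Let_def)
      \<comment> \<open>Column \<open>n + j\<close> lies in the upper right block, which holds the
        differences; with the sums from the upper left block this determines each entry.\<close>
      moreover have "v $ (i * n + j) - v $ (j * n + i) = w $ (i * n + j) - w $ (j * n + i)"
        using arg_cong[OF eq, of "\<lambda>M. M $$ (i, n + j)"] ij by (simp add: block_of_vec_def Let_def)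
      ultimately show "v $ k = w $ k"
        unfolding k_eq by linarith
    qed (use v w in simp)
  qed simp
next
  fix v :: "real vec"
  assume "v \<in> carrier_vec (n * n)"
  show "block_of_vec n v \<in> sym_skew_block_mats n"
    unfolding block_of_vec_def Let_def
    by (rule sym_skew_block_matsI) (auto intro!: eq_matI)
next
  fix M assume "M \<in> sym_skew_block_mats n"
  then obtain A S where M: "A \<in> carrier_mat n n" "S \<in> carrier_mat n n"
    "transpose_mat A = A" "transpose_mat S = - S" "M = four_block_mat A S (- S) A"
    by (rule sym_skew_block_matsE)
  \<comment> \<open>The preimage (A + S)/2 in row-major order.\<close>
  define v where "v = vec (n * n) (\<lambda>k. (A $$ (k div n, k mod n) + S $$ (k div n, k mod n)) / 2)"
  have v: "v $ (i * n + j) = (A $$ (i, j) + S $$ (i, j)) / 2" if "i < n" "j < n" for i j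
    using that index_pair_less[OF that] by (simp add: v_def)
  have "M = block_of_vec n v"
    unfolding block_of_vec_def Let_def M(5)
  proof (rule cong_four_block_mat)
    let ?X = "mat n n (\<lambda>(i, j). v $ (i * n + j))"
    show A: "A = ?X + transpose_mat ?X"
    proof (rule eq_matI)
      fix i j assume "i < dim_row (?X + transpose_mat ?X)" "j < dim_col (?X + transpose_mat ?X)"
      then show "A $$ (i, j) = (?X + transpose_mat ?X) $$ (i, j)"
        using symmetric_entry[OF M(1,3), of i j] skew_entry[OF M(2,4), of i j]
        by (simp add: v flip: add_divide_distrib diff_divide_distrib)
    qed (use M in auto)
    show S: "S = ?X - transpose_mat ?X"
    proof (rule eq_matI)
      fix i j assume "i < dim_row (?X - transpose_mat ?X)" "j < dim_col (?X - transpose_mat ?X)"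
      then show "S $$ (i, j) = (?X - transpose_mat ?X) $$ (i, j)"
        using symmetric_entry[OF M(1,3), of i j] skew_entry[OF M(2,4), of i j]
        by (simp add: v flip: add_divide_distrib diff_divide_distrib)
    qed (use M in auto)
    show "- S = - (?X - transpose_mat ?X)"
      using S by simp
    show "A = ?X + transpose_mat ?X"
      by (rule A)
  qed
  then show "\<exists>v \<in> carrier_vec (n * n). M = block_of_vec n v"
    by (auto simp: v_def)
qed

lemma block_of_vec_linear:
  "linear_map class_ring (module_vec TYPE(real) (n * n)) (sym_skew_block_space n) (block_of_vec n)"
proof -
  interpret M: vectorspace "class_ring :: real ring" "module_mat TYPE(real) (2 * n) (2 * n)"
    by (rule matrix_vs)
  interpret V: vectorspace "class_ring :: real ring" "module_vec TYPE(real) (n * n)"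
    by (rule vec_vs)
  interpret W: vectorspace "class_ring :: real ring" "sym_skew_block_space n"
    by (rule M.subspace_is_vs[OF sym_skew_block_mats_subspace])
  have maps: "block_of_vec n v \<in> sym_skew_block_mats n" if "v \<in> carrier_vec (n * n)" for v
    using block_of_vec_bij that by (rule bij_betwE[rule_format])
  let ?X = "\<lambda>v :: real vec. mat n n (\<lambda>(i, j). v $ (i * n + j))"
  have add: "block_of_vec n (v + w) = block_of_vec n v + block_of_vec n w"
    if "v \<in> carrier_vec (n * n)" "w \<in> carrier_vec (n * n)" for v w
  proof -
    \<comment> \<open>Only the passage from vector to \<open>X\<close> involves positions in the
      vector; the rest is entrywise matrix arithmetic.\<close>
    have X: "?X (v + w) = ?X v + ?X w"
      by (rule eq_matI) (use that in \<open>auto simp: index_pair_less\<close>)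
    show ?thesis
      unfolding block_of_vec_def Let_def X by (rule eq_matI) auto
  qed
  have smult: "block_of_vec n (c \<cdot>\<^sub>v v) = c \<cdot>\<^sub>m block_of_vec n v"
    if "v \<in> carrier_vec (n * n)" for c v
  proof -
    have X: "?X (c \<cdot>\<^sub>v v) = c \<cdot>\<^sub>m ?X v"
      by (rule eq_matI) (use that in \<open>auto simp: index_pair_less\<close>)
    show ?thesis
      unfolding block_of_vec_def Let_def X by (rule eq_matI) (auto simp: algebra_simps)
  qed
  have "block_of_vec n \<in> LinearCombinations.module_hom class_ring
      (module_vec TYPE(real) (n * n)) (sym_skew_block_space n)"
    unfolding LinearCombinations.module_hom_def using maps add smult by (simp add: module_vec_simps module_mat_simps)
  then show ?thesis
    by unfold_locales
qed

text \<open>The symmetric \<open>A\<close> contribute n(n+1)/2 dimensions and the skew-symmetric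
  \<open>S\<close> contribute n(n-1)/2, in total n^2, not the n^2/2 of the informal statement. For n
  = 1 the space consists of the scalar 2 x 2 matrices and has dimension 1.\<close>

theorem theorem3p1:
  fixes n :: nat
  shows "VectorSpace.subspace class_ring (sym_skew_block_mats n)
           (module_mat TYPE(real) (2 * n) (2 * n)) \<and>
         vectorspace.fin_dim class_ring (sym_skew_block_space n) \<and>
         vectorspace.dim class_ring (sym_skew_block_space n) = n\<^sup>2 \<and>
         (\<forall>M \<in> sym_skew_block_mats n. \<exists>g :: real poly. char_poly M = g\<^sup>2)"
proof -
  interpret vec_space "TYPE(real)" "n * n" .
  have bij: "bij_betw (block_of_vec n) (carrier (module_vec TYPE(real) (n * n)))
      (carrier (sym_skew_block_space n))"
    using block_of_vec_bij by (simp add: module_vec_simps)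
  \<comment> \<open>Here \<open>fin_dim\<close> refers to the coordinate space of vectors of length
    \<open>n * n\<close>.\<close>
  note dim = linear_map.dim_eq_of_bij[OF block_of_vec_linear fin_dim bij]
  have "\<exists>g :: real poly. char_poly M = g\<^sup>2" if "M \<in> sym_skew_block_mats n" for M
    using that by (rule sym_skew_block_matsE) (simp add: char_poly_rotation_block_square)
  then show ?thesis
    using sym_skew_block_mats_subspace dim dim_is_n by (simp add: power2_eq_square)
qed

end
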